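(* For every finite simple undirected graph $G$ with at least one vertex, the thicket number equals the vinewidth: $\tau(G)=\nu(G)$.
   Context: Thicket of $G=(V,E)$: a finite collection $\mathcal H$ of nonempty subsets of $V$ such that each member induces a connected subgraph of $G$ and any two members intersect. A hitting set of $\mathcal H$ is a vertex set meeting every member; the hitting size $\tau(\mathcal H)$ is the minimum cardinality of a hitting set. The thicket number $\tau(G)$ is the maximum of $\tau(\mathcal H)$ over all thickets of $G$. Vine decomposition of $G$: a pair $(T,\ell)$ where $T$ is a tree and $\ell$ assigns to each node $t$ of $T$ a set $V_t\subseteq V$, such that, writing $T_v=\{t: v\in V_t\}$: (i) for each $v\in V$, $T_v$ is nonempty and induces a connected subtree of $T$; (ii) for each edge $uv\in E$, the subtrees $T_u$ and $T_v$ either share a node or some node of $T_u$ is adjacent in $T$ to some node of $T_v$. Its width is $\max_t|V_t|$, and the vinewidth $\nu(G)$ is the minimum width of a vine decomposition of $G$. *)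

theory Defs
  imports Main
begin

definition simple_graph :: "'a set \<Rightarrow> 'a set set \<Rightarrow> bool" where
  "simple_graph V E \<longleftrightarrow> finite V \<and>
     (\<forall>e\<in>E. \<exists>u v. e = {u, v} \<and> u \<noteq> v \<and> u \<in> V \<and> v \<in> V)"

definition induces_connected :: "'a set \<Rightarrow> 'a set set \<Rightarrow> 'a set \<Rightarrow> bool" where
  "induces_connected V E X \<longleftrightarrow> X \<noteq> {} \<and> X \<subseteq> V \<and>
     (\<forall>u\<in>X. \<forall>v\<in>X. (\<lambda>a b. {a, b} \<in> E \<and> a \<in> X \<and> b \<in> X)\<^sup>*\<^sup>* u v)"

definition thicket :: "'a set \<Rightarrow> 'a set set \<Rightarrow> 'a set set \<Rightarrow> bool" where
  "thicket V E H \<longleftrightarrow> finite H \<and> (\<forall>X\<in>H. X \<noteq> {} \<and> X \<subseteq> V \<and> induces_connected V E X) \<and>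
     (\<forall>X\<in>H. \<forall>Y\<in>H. X \<inter> Y \<noteq> {})"

definition hitting_set :: "'a set \<Rightarrow> 'a set set \<Rightarrow> 'a set \<Rightarrow> bool" where
  "hitting_set V H S \<longleftrightarrow> S \<subseteq> V \<and> (\<forall>X\<in>H. S \<inter> X \<noteq> {})"

definition hitting_size :: "'a set \<Rightarrow> 'a set set \<Rightarrow> nat" where
  "hitting_size V H = (LEAST k. \<exists>S. hitting_set V H S \<and> card S = k)"

definition thicket_number :: "'a set \<Rightarrow> 'a set set \<Rightarrow> nat" where
  "thicket_number V E = Max (hitting_size V ` {H. thicket V E H})"

text \<open>A (finite) tree with nodes N and edges F: a simple graph that is connected and
  acyclic (every edge is a bridge, i.e. lies on no cycle). Nodes are natural numbers,
  which loses no generality since every finite tree is isomorphic to one on nat.\<close>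
definition is_tree :: "nat set \<Rightarrow> nat set set \<Rightarrow> bool" where
  "is_tree N F \<longleftrightarrow> simple_graph N F \<and> induces_connected N F N \<and>
     (\<forall>e\<in>F. \<forall>a b. e = {a, b} \<longrightarrow>
        \<not> (\<lambda>x y. {x, y} \<in> F - {e})\<^sup>*\<^sup>* a b)"

definition node_set :: "nat set \<Rightarrow> (nat \<Rightarrow> 'a set) \<Rightarrow> 'a \<Rightarrow> nat set" where
  "node_set N lab v = {t \<in> N. v \<in> lab t}"

definition vine_decomposition ::
  "'a set \<Rightarrow> 'a set set \<Rightarrow> nat set \<Rightarrow> nat set set \<Rightarrow> (nat \<Rightarrow> 'a set) \<Rightarrow> bool" where
  "vine_decomposition V E N F lab \<longleftrightarrow> is_tree N F \<and> (\<forall>t\<in>N. lab t \<subseteq> V) \<and>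
     (\<forall>v\<in>V. induces_connected N F (node_set N lab v)) \<and>
     (\<forall>u v. {u, v} \<in> E \<longrightarrow>
        node_set N lab u \<inter> node_set N lab v \<noteq> {} \<or>
        (\<exists>s\<in>node_set N lab u. \<exists>t\<in>node_set N lab v. {s, t} \<in> F))"

definition vine_width :: "nat set \<Rightarrow> (nat \<Rightarrow> 'a set) \<Rightarrow> nat" where
  "vine_width N lab = Max ((\<lambda>t. card (lab t)) ` N)"

definition vinewidth :: "'a set \<Rightarrow> 'a set set \<Rightarrow> nat" where
  "vinewidth V E = (LEAST k. \<exists>N F lab. vine_decomposition V E N F lab \<and> vine_width N lab = k)"

end

theory Submission
  imports Defs
begin

text \<open>
  In one direction, a thicket member \<open>Y\<close> meets the bags of a connected set of nodes, members meet
  pairwise, and so by the Helly property of subtrees some bag is a hitting set.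

  The other direction adapts the proof of tree-width duality by Bellenbaum and Diestel. Call a vine
  decomposition admissible for a thicket \<open>H\<close> if each bag with more than \<open>k\<close> vertices fails to hit
  \<open>H\<close>, where \<open>k\<close> is the thicket number. Admissible decompositions exist for all \<open>H\<close>, by downward
  induction on \<open>H\<close>; the empty thicket then gives width at most \<open>k\<close>. Let \<open>X\<close> be a minimum hitting
  set of \<open>H\<close>. For each component \<open>C\<close> of \<open>G - X\<close> one decomposes \<open>G[X \<union> C]\<close> with \<open>X\<close> as a bag, and
  joins the pieces at \<open>X\<close>. If \<open>C\<close> misses a member of \<open>H\<close>, the two bags \<open>X\<close> and \<open>C\<close> suffice.
  Otherwise \<open>H \<union> {C}\<close> is a thicket; a large bag hitting \<open>H\<close> in a decomposition admissible for it
  avoids \<open>C\<close>, and by minimality of \<open>X\<close> this bag is linked to all of \<open>X\<close> outside \<open>C\<close>. Contracting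
  the linkage onto \<open>X\<close> turns the bag into \<open>X\<close>.
\<close>

section \<open>Connectivity via cuts\<close>

text \<open>Cuts instead of walks: the later arguments need only one edge leaving a set. No ambient
  vertex set occurs, so edge sets can be enlarged or mapped freely.\<close>

definition connected_in :: "'a set set \<Rightarrow> 'a set \<Rightarrow> bool" where
  "connected_in E X \<longleftrightarrow> X \<noteq> {} \<and>
     (\<forall>U\<subseteq>X. U \<noteq> {} \<and> U \<noteq> X \<longrightarrow> (\<exists>a\<in>U. \<exists>b\<in>X - U. {a, b} \<in> E))"

lemma connected_in_crossing:
  assumes "connected_in E X" "x \<in> X" "x \<in> U" "y \<in> X" "y \<notin> U"
  obtains a b where "a \<in> X" "a \<in> U" "b \<in> X" "b \<notin> U" "{a, b} \<in> E"
proof -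
  have "X \<inter> U \<subseteq> X" "X \<inter> U \<noteq> {}" "X \<inter> U \<noteq> X" using assms by auto
  then obtain a b where "a \<in> X \<inter> U" "b \<in> X - X \<inter> U" "{a, b} \<in> E"
    using assms(1) unfolding connected_in_def by meson
  then show thesis using that by blast
qed

text \<open>A part of \<open>X\<close> with no edge to the rest traps every walk starting in it;
  conversely, the vertices reachable from \<open>u\<close> would form such a part.\<close>

lemma induces_connected_iff:
  "induces_connected V E X \<longleftrightarrow> X \<subseteq> V \<and> connected_in E X"
proof
  assume L: "induces_connected V E X"
  have "\<exists>a\<in>U. \<exists>b\<in>X - U. {a, b} \<in> E" if U: "U \<subseteq> X" "U \<noteq> {}" "U \<noteq> X" for U
  proof (rule ccontr)
    assume no: "\<not> ?thesis"
    obtain u v where uv: "u \<in> U" "v \<in> X" "v \<notin> U" using U by blast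
    then have "(\<lambda>a b. {a, b} \<in> E \<and> a \<in> X \<and> b \<in> X)\<^sup>*\<^sup>* u v"
      using L U unfolding induces_connected_def by blast
    then have "v \<in> U"
      by (induction rule: rtranclp_induct) (use no uv in auto)
    then show False using uv by blast
  qed
  then show "X \<subseteq> V \<and> connected_in E X"
    using L unfolding induces_connected_def connected_in_def by blast
next
  assume R: "X \<subseteq> V \<and> connected_in E X"
  have "(\<lambda>a b. {a, b} \<in> E \<and> a \<in> X \<and> b \<in> X)\<^sup>*\<^sup>* u v" (is "?r\<^sup>*\<^sup>* u v")
    if uv: "u \<in> X" "v \<in> X" for u v
  proof (rule ccontr)
    assume "\<not> ?thesis"
    then obtain a b where "a \<in> X" "?r\<^sup>*\<^sup>* u a" "b \<in> X" "\<not> ?r\<^sup>*\<^sup>* u b" "{a, b} \<in> E"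
      using connected_in_crossing[of E X u "{w. ?r\<^sup>*\<^sup>* u w}" v] R uv by auto
    then show False using rtranclp.rtrancl_into_rtrancl[of ?r u a b] by blast
  qed
  then show "induces_connected V E X"
    using R unfolding induces_connected_def connected_in_def by blast
qed

lemma connected_in_singleton: "connected_in E {x}"
  unfolding connected_in_def by auto

text \<open>A split of the union puts the common vertex \<open>v\<close> on one side; a member
  reaching the other side is itself split and supplies the edge.\<close>

lemma connected_in_Union:
  assumes "\<And>D. D \<in> \<D> \<Longrightarrow> connected_in E D" "\<And>D. D \<in> \<D> \<Longrightarrow> v \<in> D" "\<D> \<noteq> {}"
  shows "connected_in E (\<Union>\<D>)"
  unfolding connected_in_def
proof (intro conjI allI impI)
  show "\<Union>\<D> \<noteq> {}" using assms by blast
  fix U assume U: "U \<subseteq> \<Union>\<D>" "U \<noteq> {} \<and> U \<noteq> \<Union>\<D>"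
  show "\<exists>a\<in>U. \<exists>b\<in>\<Union>\<D> - U. {a, b} \<in> E"
  proof (cases "v \<in> U")
    case True
    obtain y D where yD: "y \<in> D" "D \<in> \<D>" "y \<notin> U" using U by blast
    then obtain a b where "a \<in> U" "b \<in> D" "b \<notin> U" "{a, b} \<in> E"
      using connected_in_crossing[of E D v U y] assms True by metis
    then show ?thesis using yD by blast
  next
    case False
    obtain y D where yD: "y \<in> D" "D \<in> \<D>" "y \<in> U" using U by blast
    then obtain a b where "a \<in> U" "b \<in> D" "b \<notin> U" "{a, b} \<in> E"
      using connected_in_crossing[of E D y U v] assms False by metis
    then show ?thesis using yD by blast
  qed
qed

lemma connected_in_Un:
  assumes "connected_in E A" "connected_in E B" "A \<inter> B \<noteq> {}"
  shows "connected_in E (A \<union> B)"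
proof -
  obtain v where "v \<in> A" "v \<in> B" using assms(3) by blast
  then show ?thesis using connected_in_Union[of "{A, B}" E v] assms by auto
qed

lemma connected_in_Un_edge:
  assumes "connected_in E A" "connected_in E B" "a \<in> A" "b \<in> B" "{a, b} \<in> E"
  shows "connected_in E (A \<union> B)"
proof -
  have "connected_in E {a, b}"
    unfolding connected_in_def
  proof (intro conjI allI impI)
    fix U assume "U \<subseteq> {a, b}" "U \<noteq> {} \<and> U \<noteq> {a, b}"
    then have "(U = {a} \<or> U = {b}) \<and> a \<noteq> b" by blast
    then show "\<exists>x\<in>U. \<exists>y\<in>{a, b} - U. {x, y} \<in> E"
      using assms(5) by (auto simp: insert_commute)
  qed simp
  then have "connected_in E (A \<union> {a, b})" using connected_in_Un[of E A "{a, b}"] assms by blast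
  then have "connected_in E (A \<union> {a, b} \<union> B)" using connected_in_Un[of E _ B] assms by blast
  moreover have "A \<union> {a, b} \<union> B = A \<union> B" using assms by blast
  ultimately show ?thesis by simp
qed

lemma connected_in_insert:
  assumes "connected_in E A" "a \<in> A" "{a, b} \<in> E"
  shows "connected_in E (insert b A)"
  using connected_in_Un_edge[OF assms(1) connected_in_singleton assms(2) _ assms(3)] by simp

lemma connected_in_mono:
  assumes "connected_in E X" "E \<subseteq> E'"
  shows "connected_in E' X"
  using assms unfolding connected_in_def by (meson subsetD)

lemma connected_in_image:
  assumes "connected_in E X"
  shows "connected_in ((`) f ` E) (f ` X)"
  unfolding connected_in_def
proof (intro conjI allI impI)
  show "f ` X \<noteq> {}" using assms unfolding connected_in_def by blast
  fix U assume U: "U \<subseteq> f ` X" "U \<noteq> {} \<and> U \<noteq> f ` X"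
  then obtain x y where "x \<in> X" "f x \<in> U" "y \<in> X" "f y \<notin> U" by blast
  then obtain a b where "a \<in> X" "f a \<in> U" "b \<in> X" "f b \<notin> U" "{a, b} \<in> E"
    using connected_in_crossing[OF assms, of x "f -` U" y] by auto
  moreover from this have "{f a, f b} \<in> (`) f ` E" by (metis image_eqI image_insert image_empty)
  ultimately show "\<exists>a\<in>U. \<exists>b\<in>f ` X - U. {a, b} \<in> (`) f ` E" by blast
qed

text \<open>The union of all connected subsets of \<open>S\<close> through \<open>v\<close> is
  connected, and an edge to a further vertex of \<open>S\<close> would enlarge it.\<close>

lemma connected_component_exists:
  assumes "v \<in> S"
  obtains C where "v \<in> C" "C \<subseteq> S" "connected_in E C"
    "\<And>c w. c \<in> C \<Longrightarrow> w \<in> S - C \<Longrightarrow> {c, w} \<notin> E"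
proof -
  define \<D> where "\<D> = {D. connected_in E D \<and> v \<in> D \<and> D \<subseteq> S}"
  have v: "{v} \<in> \<D>" using assms connected_in_singleton unfolding \<D>_def by auto
  have C: "connected_in E (\<Union>\<D>)"
    by (rule connected_in_Union[where v = v]) (use v in \<open>auto simp: \<D>_def\<close>)
  show thesis
  proof
    show "v \<in> \<Union>\<D>" using v by blast
    show "\<Union>\<D> \<subseteq> S" unfolding \<D>_def by blast
    show "connected_in E (\<Union>\<D>)" by (rule C)
    fix c w assume cw: "c \<in> \<Union>\<D>" "w \<in> S - \<Union>\<D>"
    show "{c, w} \<notin> E"
    proof
      assume "{c, w} \<in> E"
      then have "connected_in E (insert w (\<Union>\<D>))" using connected_in_insert[OF C cw(1)] by blast
      then have "insert w (\<Union>\<D>) \<in> \<D>"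
        using v cw \<open>\<Union>\<D> \<subseteq> S\<close> unfolding \<D>_def by blast
      then show False using cw by blast
    qed
  qed
qed

section \<open>Trees\<close>

text \<open>An edge is a bridge iff it is the only edge across some cut; for a bridge, the vertices
  reachable from \<open>a\<close> without it form that cut.\<close>

lemma is_tree_iff:
  "is_tree N F \<longleftrightarrow> simple_graph N F \<and> connected_in F N \<and>
     (\<forall>a b. {a, b} \<in> F \<longrightarrow>
        (\<exists>A. a \<in> A \<and> b \<notin> A \<and> (\<forall>x y. x \<in> A \<longrightarrow> y \<notin> A \<longrightarrow> {x, y} \<in> F \<longrightarrow> x = a \<and> y = b)))"
    (is "_ \<longleftrightarrow> _ \<and> _ \<and> ?cuts")
proof -
  have "(\<forall>e\<in>F. \<forall>a b. e = {a, b} \<longrightarrow> \<not> (\<lambda>x y. {x, y} \<in> F - {e})\<^sup>*\<^sup>* a b) \<longleftrightarrow> ?cuts" (is "?L \<longleftrightarrow> _")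
  proof
    assume L: ?L
    show ?cuts
    proof (intro allI impI)
      fix a b assume ab: "{a, b} \<in> F"
      let ?r = "\<lambda>x y. {x, y} \<in> F - {{a, b}}"
      have nb: "\<not> ?r\<^sup>*\<^sup>* a b" using L ab by blast
      have "x = a \<and> y = b" if "?r\<^sup>*\<^sup>* a x" "\<not> ?r\<^sup>*\<^sup>* a y" "{x, y} \<in> F" for x y
      proof -
        have "{x, y} = {a, b}" using that rtranclp.rtrancl_into_rtrancl[of ?r a x y] by blast
        then show ?thesis using that nb by (auto simp: doubleton_eq_iff)
      qed
      then show "\<exists>A. a \<in> A \<and> b \<notin> A \<and> (\<forall>x y. x \<in> A \<longrightarrow> y \<notin> A \<longrightarrow> {x, y} \<in> F \<longrightarrow> x = a \<and> y = b)"
        using nb by (intro exI[of _ "{x. ?r\<^sup>*\<^sup>* a x}"]) auto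
    qed
  next
    assume cuts: ?cuts
    show ?L
    proof (intro ballI allI impI notI)
      fix e a b assume e: "e \<in> F" "e = {a, b}" and "(\<lambda>x y. {x, y} \<in> F - {e})\<^sup>*\<^sup>* a b"
      obtain A where A: "a \<in> A" "b \<notin> A" "\<And>x y. x \<in> A \<Longrightarrow> y \<notin> A \<Longrightarrow> {x, y} \<in> F \<Longrightarrow> x = a \<and> y = b"
        using cuts e by metis
      have "b \<in> A"
        using \<open>(\<lambda>x y. {x, y} \<in> F - {e})\<^sup>*\<^sup>* a b\<close>
      proof (induction rule: rtranclp_induct)
        case (step y z)
        then show ?case using A(3)[of y z] e by blast
      qed (rule A(1))
      then show False using A by blast
    qed
  qed
  then show ?thesis
    unfolding is_tree_def induces_connected_iff by (simp only: subset_refl simp_thms)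
qed

text \<open>A connected set meeting both sides of the cut of a tree edge must use that edge, hence
  contains both its ends.\<close>

lemma tree_cut:
  assumes "is_tree N F" "{a, b} \<in> F"
  shows "\<exists>A. \<forall>S. connected_in F S \<longrightarrow>
    (a \<in> S \<and> b \<notin> S \<longrightarrow> S \<subseteq> A) \<and> (b \<in> S \<and> a \<notin> S \<longrightarrow> S \<inter> A = {}) \<and>
    (S \<inter> A \<noteq> {} \<and> \<not> S \<subseteq> A \<longrightarrow> b \<in> S)"
proof -
  obtain A where A: "a \<in> A" "b \<notin> A" "\<And>x y. x \<in> A \<Longrightarrow> y \<notin> A \<Longrightarrow> {x, y} \<in> F \<Longrightarrow> x = a \<and> y = b"
    using assms unfolding is_tree_iff by metis
  have cross: "a \<in> S \<and> b \<in> S" if "connected_in F S" "u \<in> S" "u \<in> A" "v \<in> S" "v \<notin> A" for S u v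
    using connected_in_crossing[OF that] A(3) by metis
  show ?thesis
    by (intro exI[of _ A]) (use cross A(1,2) in blast)
qed

text \<open>If \<open>v\<close> lay outside the component \<open>R\<close> of \<open>u\<close> in
  the intersection, \<open>S1\<close> would enter \<open>R\<close> from the side of \<open>v\<close>
  through an edge whose outer end \<open>b\<close> is not in \<open>S2\<close>. The cut of this edge
  separates \<open>u\<close> from \<open>v\<close>, so \<open>S2\<close> cannot join them without
  \<open>b\<close>.\<close>

lemma tree_connected_Int:
  assumes T: "is_tree N F" and S: "connected_in F S1" "connected_in F S2" and ne: "S1 \<inter> S2 \<noteq> {}"
  shows "connected_in F (S1 \<inter> S2)"
proof -
  obtain u where u: "u \<in> S1 \<inter> S2" using ne by blast
  obtain R where R: "u \<in> R" "R \<subseteq> S1 \<inter> S2" "connected_in F R"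
    "\<And>c w. c \<in> R \<Longrightarrow> w \<in> S1 \<inter> S2 - R \<Longrightarrow> {c, w} \<notin> F"
    using connected_component_exists[OF u] by metis
  have "v \<in> R" if v: "v \<in> S1 \<inter> S2" for v
  proof (rule ccontr)
    assume "v \<notin> R"
    then have "v \<in> S1 - R" using v by blast
    then obtain Q where Q: "v \<in> Q" "Q \<subseteq> S1 - R" "connected_in F Q"
      "\<And>c w. c \<in> Q \<Longrightarrow> w \<in> S1 - R - Q \<Longrightarrow> {c, w} \<notin> F"
      using connected_component_exists[of v "S1 - R" F] by metis
    obtain b a where ab: "b \<in> S1" "b \<in> Q" "a \<in> S1" "a \<notin> Q" "{b, a} \<in> F"
      using connected_in_crossing[OF S(1), of v Q u] v u Q R by blast
    \<comment> \<open>\<open>Q\<close> is a full component of \<open>S1 - R\<close>, so an edge of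
      \<open>S1\<close> leaving it ends in \<open>R\<close>.\<close>
    have a: "a \<in> R" using Q(4) ab by blast
    have e: "{a, b} \<in> F" using ab by (simp add: insert_commute)
    \<comment> \<open>Otherwise \<open>b\<close> would be a further vertex of the intersection
      adjacent to its component \<open>R\<close>.\<close>
    have b: "b \<notin> S2" using R(4)[OF a, of b] e ab Q(2) by blast
    obtain A where A: "\<forall>S. connected_in F S \<longrightarrow>
      (a \<in> S \<and> b \<notin> S \<longrightarrow> S \<subseteq> A) \<and> (b \<in> S \<and> a \<notin> S \<longrightarrow> S \<inter> A = {}) \<and>
      (S \<inter> A \<noteq> {} \<and> \<not> S \<subseteq> A \<longrightarrow> b \<in> S)"
      using tree_cut[OF T e] by meson
    have "R \<subseteq> A" using A R(3) a ab Q(2) by blast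
    moreover have "Q \<inter> A = {}" using A Q(3) ab by blast
    ultimately show False using A S(2) u v R(1) Q(1) b by blast
  qed
  then have "S1 \<inter> S2 = R" using R by blast
  then show ?thesis using R by simp
qed

text \<open>Without a common node, the subtree \<open>(S1 \<union> S2) \<inter> S3\<close> contains
  an edge from \<open>S1\<close> to \<open>S2\<close>, and the cut of that edge separates
  \<open>S1\<close> from \<open>S2\<close>.\<close>

lemma tree_Helly_three:
  assumes T: "is_tree N F" and S: "connected_in F S1" "connected_in F S2" "connected_in F S3"
    and ne: "S1 \<inter> S2 \<noteq> {}" "S1 \<inter> S3 \<noteq> {}" "S2 \<inter> S3 \<noteq> {}"
  shows "S1 \<inter> S2 \<inter> S3 \<noteq> {}"
proof
  assume E: "S1 \<inter> S2 \<inter> S3 = {}"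
  have "(S1 \<union> S2) \<inter> S3 \<noteq> {}" using ne by blast
  then have c: "connected_in F ((S1 \<union> S2) \<inter> S3)"
    using tree_connected_Int[OF T] connected_in_Un[OF S(1,2) ne(1)] S(3) by blast
  obtain x y where xy: "x \<in> S1 \<inter> S3" "y \<in> S2 \<inter> S3" using ne by blast
  obtain a b where ab: "a \<in> S1 \<inter> S3" "b \<in> S2 \<inter> S3" "b \<notin> S1" "{a, b} \<in> F"
    by (rule connected_in_crossing[OF c, of x S1 y]) (use xy E that in auto)
  then have "a \<notin> S2" using E by blast
    obtain A where A: "\<forall>S. connected_in F S \<longrightarrow>
      (a \<in> S \<and> b \<notin> S \<longrightarrow> S \<subseteq> A) \<and> (b \<in> S \<and> a \<notin> S \<longrightarrow> S \<inter> A = {}) \<and>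
      (S \<inter> A \<noteq> {} \<and> \<not> S \<subseteq> A \<longrightarrow> b \<in> S)"
      using tree_cut[OF T ab(4)] by meson
  have "S1 \<subseteq> A" using A S(1) ab by blast
  moreover have "S2 \<inter> A = {}" using A S(2) ab \<open>a \<notin> S2\<close> by blast
  ultimately show False using ne by blast
qed

lemma tree_Helly:
  assumes T: "is_tree N F" and "finite \<S>" "\<S> \<noteq> {}"
    and "\<And>S. S \<in> \<S> \<Longrightarrow> connected_in F S" "\<And>S S'. S \<in> \<S> \<Longrightarrow> S' \<in> \<S> \<Longrightarrow> S \<inter> S' \<noteq> {}"
  shows "\<Inter>\<S> \<noteq> {}"
proof -
  \<comment> \<open>The induction carries along that the intersection is a subtree and meets every
    subtree meeting all members; the three-set case then adds one member.\<close>
  have "connected_in F (\<Inter>\<S>) \<and>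
      (\<forall>S'. connected_in F S' \<and> (\<forall>S\<in>\<S>. S \<inter> S' \<noteq> {}) \<longrightarrow> \<Inter>\<S> \<inter> S' \<noteq> {})"
    using assms(2-5)
  proof (induction rule: finite_ne_induct)
    case (singleton S)
    then show ?case by simp
  next
    case (insert S0 \<S>)
    have c: "connected_in F (\<Inter>\<S>)" and
      h: "\<And>S'. connected_in F S' \<Longrightarrow> \<forall>S\<in>\<S>. S \<inter> S' \<noteq> {} \<Longrightarrow> \<Inter>\<S> \<inter> S' \<noteq> {}"
      using insert.IH insert.prems by simp_all
    have S0: "connected_in F S0" using insert.prems by simp
    have ne: "\<Inter>\<S> \<inter> S0 \<noteq> {}" using h[OF S0] insert.prems(2) by blast
    have "\<Inter>\<S> \<inter> S0 \<inter> S' \<noteq> {}"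
      if "connected_in F S'" "\<forall>S\<in>insert S0 \<S>. S \<inter> S' \<noteq> {}" for S'
      using tree_Helly_three[OF T c S0 that(1) ne] h[OF that(1)] that(2) by simp
    then show ?case
      using tree_connected_Int[OF T c S0 ne] by (simp add: Int_commute)
  qed
  then show ?thesis unfolding connected_in_def by blast
qed

text \<open>A subtree around \<open>Z\<close> of least cardinality lies in every other one, since
  intersections of subtrees are subtrees.\<close>

lemma tree_hull:
  assumes T: "is_tree N F" and Z: "Z \<subseteq> N" "Z \<noteq> {}"
  obtains S where "connected_in F S" "Z \<subseteq> S" "S \<subseteq> N"
    "\<And>S'. connected_in F S' \<Longrightarrow> Z \<subseteq> S' \<Longrightarrow> S \<subseteq> S'"
proof -
  have fin: "finite N" and N: "connected_in F N"
    using T unfolding is_tree_iff simple_graph_def by auto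
  let ?Q = "\<lambda>S. connected_in F S \<and> Z \<subseteq> S \<and> S \<subseteq> N"
  obtain S where S: "?Q S" and least: "\<And>S'. ?Q S' \<Longrightarrow> card S \<le> card S'"
    using ex_has_least_nat[of ?Q N card] N Z by auto
  have "S \<subseteq> S'" if "connected_in F S'" "Z \<subseteq> S'" for S'
  proof -
    have "S \<inter> S' \<noteq> {}" using S that Z by blast
    then have "?Q (S \<inter> S')" using tree_connected_Int[OF T] S that by blast
    then have "card S \<le> card (S \<inter> S')" by (rule least)
    then have "S \<inter> S' = S"
      by (intro card_seteq) (use S fin finite_subset in auto)
    then show ?thesis by blast
  qed
  then show thesis using S that by blast
qed

section \<open>Linking a minimum separator\<close>

text \<open>A separator given by its near side: every connected subset of \<open>V\<close> meeting
  both \<open>U\<close> and \<open>B\<close> meets it. Indexing by \<open>U\<close> makes its size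
  submodular.\<close>

definition boundary :: "'a set set \<Rightarrow> 'a set \<Rightarrow> 'a set \<Rightarrow> 'a set \<Rightarrow> 'a set" where
  "boundary E V B U = {u \<in> U. u \<in> B \<or> (\<exists>w\<in>V - U. {u, w} \<in> E)}"

text \<open>The union of the two boundaries on the left lies in the union of those on the right, and
  likewise for the intersections.\<close>

lemma boundary_submodular:
  assumes "finite U" "finite W"
  shows "card (boundary E V B (U \<union> W)) + card (boundary E V B (U \<inter> W))
    \<le> card (boundary E V B U) + card (boundary E V B W)" (is "card ?a + card ?b \<le> card ?c + card ?d")
proof -
  have fin: "finite ?a" "finite ?b" "finite ?c" "finite ?d"
    using assms unfolding boundary_def by auto
  have "card ?a + card ?b = card (?a \<union> ?b) + card (?a \<inter> ?b)"
    using card_Un_Int fin by blast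
  also have "\<dots> \<le> card (?c \<union> ?d) + card (?c \<inter> ?d)"
    by (intro add_mono card_mono) (use fin in \<open>auto simp: boundary_def\<close>)
  also have "\<dots> = card ?c + card ?d" using card_Un_Int[OF fin(3,4)] by simp
  finally show ?thesis .
qed

text \<open>The half of Menger's theorem needed here, with paths relaxed to connected sets. The induction
  moves a vertex \<open>a\<close> of \<open>A\<close> to a neighbour outside the largest tight set around \<open>A - {a}\<close>.\<close>
lemma Menger_linkage:
  assumes "finite V" "A \<subseteq> V"
    and "\<And>U. A \<subseteq> U \<Longrightarrow> U \<subseteq> V \<Longrightarrow> card A \<le> card (boundary E V B U)"
  shows "\<exists>P. (\<forall>a\<in>A. a \<in> P a \<and> P a \<subseteq> V \<and> connected_in E (P a) \<and> P a \<inter> B \<noteq> {}) \<and>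
    (\<forall>a\<in>A. \<forall>b\<in>A. a \<noteq> b \<longrightarrow> P a \<inter> P b = {})"
  using assms
proof (induction V arbitrary: A rule: finite_psubset_induct)
  case (psubset V)
  note lower = psubset.prems(2)
  have finV: "finite V" by (rule psubset.hyps)
  then have finA: "finite A" using psubset.prems(1) finite_subset by blast
  show ?case
  proof (cases "A \<subseteq> B")
    case True
    then show ?thesis
      using psubset.prems(1) by (intro exI[of _ "\<lambda>a. {a}"]) (auto simp: connected_in_singleton)
  next
    case False
    then obtain a where a: "a \<in> A" "a \<notin> B" by blast
    define V' where "V' = V - {a}"
    define A0 where "A0 = A - {a}"
    have V': "V' \<subset> V" "finite V'" using a finV psubset.prems(1) unfolding V'_def by auto
    have A0: "A = insert a A0" "a \<notin> A0" "A0 \<subseteq> V'" "finite A0"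
      using a finA psubset.prems(1) unfolding A0_def V'_def by auto
    have cA: "card A = Suc (card A0)" using A0 by simp
    \<comment> \<open>As \<open>V - insert a U = V' - U\<close>, the outside neighbours are the same
      and only \<open>a\<close> can be new.\<close>
    have grow: "boundary E V B (insert a U) \<subseteq> insert a (boundary E V' B U)" if "U \<subseteq> V'" for U
      using that unfolding boundary_def V'_def by blast
    have lower0: "card A0 \<le> card (boundary E V' B U)" if "A0 \<subseteq> U" "U \<subseteq> V'" for U
    proof -
      have "finite U" using that V' finite_subset by blast
      then have fin: "finite (boundary E V' B U)" unfolding boundary_def by simp
      have "card A \<le> card (boundary E V B (insert a U))"
        by (rule lower) (use that A0 psubset.prems(1) V' in auto)
      also have "\<dots> \<le> card (insert a (boundary E V' B U))"
        using grow[OF that(2)] fin by (intro card_mono) auto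
      also have "\<dots> \<le> Suc (card (boundary E V' B U))" using card_insert_le_m1 fin
        by (simp add: card_insert_if)
      finally show ?thesis using cA by simp
    qed
    \<comment> \<open>These are the tight sets: by \<open>lower0\<close> their boundary has exactly
      \<open>card A0\<close> vertices.\<close>
    let ?Q = "\<lambda>U. A0 \<subseteq> U \<and> U \<subseteq> V' \<and> card (boundary E V' B U) \<le> card A0"
    have "boundary E V' B A0 \<subseteq> A0" unfolding boundary_def by blast
    then have "?Q A0" using A0 card_mono by blast
    moreover have "\<forall>U. ?Q U \<longrightarrow> card U < Suc (card V')"
      using V' card_mono le_imp_less_Suc by blast
    ultimately obtain U where U: "?Q U" and max: "\<And>W. ?Q W \<Longrightarrow> card W \<le> card U"
      using ex_has_greatest_nat[of ?Q A0 card "Suc (card V')"] by metis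
    have finU: "finite U" using U V' finite_subset by blast
    \<comment> \<open>Otherwise adding \<open>a\<close>, which is not in \<open>B\<close>, to
      \<open>U\<close> would leave a boundary of fewer than \<open>card A\<close> vertices.\<close>
    have "\<exists>v\<in>V' - U. {a, v} \<in> E"
    proof (rule ccontr)
      assume "\<not> ?thesis"
      then have "boundary E V B (insert a U) \<subseteq> boundary E V' B U"
        using U a(2) unfolding boundary_def V'_def by blast
      moreover have "finite (boundary E V' B U)" using finU unfolding boundary_def by simp
      ultimately have "card (boundary E V B (insert a U)) \<le> card A0"
        using U card_mono le_trans by blast
      moreover have "card A \<le> card (boundary E V B (insert a U))"
        by (rule lower) (use U A0 psubset.prems(1) V' in auto)
      ultimately show False using cA by simp
    qed
    then obtain v where v: "v \<in> V'" "v \<notin> U" "{a, v} \<in> E" by blast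
    have vA0: "v \<notin> A0" using v U by blast
    \<comment> \<open>A violating \<open>W\<close> is tight; by submodularity so is
      \<open>U \<union> W\<close>, which contains \<open>v\<close> and thus exceeds the largest
      tight set.\<close>
    have low: "card (insert v A0) \<le> card (boundary E V' B W)"
      if W: "insert v A0 \<subseteq> W" "W \<subseteq> V'" for W
    proof (rule ccontr)
      assume "\<not> ?thesis"
      then have small: "card (boundary E V' B W) \<le> card A0" using vA0 A0 by simp
      have finW: "finite W" using W V' finite_subset by blast
      have "card A0 \<le> card (boundary E V' B (U \<inter> W))"
        by (rule lower0) (use U W in auto)
      then have "card (boundary E V' B (U \<union> W)) \<le> card A0"
        using boundary_submodular[OF finU finW, of E V' B] U small by linarith
      then have "card (U \<union> W) \<le> card U" by (intro max) (use U W in auto)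
      moreover have "card U < card (U \<union> W)"
        by (intro psubset_card_mono) (use finU finW v W in auto)
      ultimately show False by simp
    qed
    have "insert v A0 \<subseteq> V'" using v(1) A0(3) by blast
    then have "\<exists>P. (\<forall>x\<in>insert v A0. x \<in> P x \<and> P x \<subseteq> V' \<and> connected_in E (P x) \<and> P x \<inter> B \<noteq> {}) \<and>
        (\<forall>x\<in>insert v A0. \<forall>y\<in>insert v A0. x \<noteq> y \<longrightarrow> P x \<inter> P y = {})"
      by (rule psubset.IH[OF V'(1)]) (rule low)
    then obtain P where
      P0: "\<forall>x\<in>insert v A0. x \<in> P x \<and> P x \<subseteq> V' \<and> connected_in E (P x) \<and> P x \<inter> B \<noteq> {}" and
      disj: "\<forall>x\<in>insert v A0. \<forall>y\<in>insert v A0. x \<noteq> y \<longrightarrow> P x \<inter> P y = {}"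
      by (elim exE conjE)
    have P: "x \<in> P x" "P x \<subseteq> V'" "connected_in E (P x)" "P x \<inter> B \<noteq> {}" if "x \<in> insert v A0" for x
      using P0[rule_format, OF that] by simp_all
    \<comment> \<open>The edge \<open>{a, v}\<close> extends the set of \<open>v\<close> to
      \<open>a\<close>; as \<open>a\<close> is outside \<open>V'\<close>, disjointness
      persists.\<close>
    define P' where "P' = (\<lambda>x. if x = a then insert a (P v) else P x)"
    have "connected_in E (insert a (P v))"
      using connected_in_insert[OF P(3) P(1), of v a] v(3) by (simp add: insert_commute)
    then have new: "x \<in> P' x \<and> P' x \<subseteq> V \<and> connected_in E (P' x) \<and> P' x \<inter> B \<noteq> {}" if "x \<in> A" for x
    proof (cases "x = a")
      case True
      have "P v \<subseteq> V" using P(2)[of v] V'(1) by blast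
      then show ?thesis
        using True \<open>connected_in E (insert a (P v))\<close> P(4)[of v] a(1) psubset.prems(1)
        unfolding P'_def by auto
    next
      case False
      then have "x \<in> insert v A0" using that A0(1) by blast
      then show ?thesis using P[of x] False V'(1) unfolding P'_def by auto
    qed
    have aP: "a \<notin> P z" if "z \<in> A0" for z using P(2)[of z] that unfolding V'_def by blast
    have vP: "P v \<inter> P z = {}" if "z \<in> A0" for z using disj[rule_format, of v z] that vA0 by auto
    have "P' x \<inter> P' y = {}" if "x \<in> A" "y \<in> A" "x \<noteq> y" for x y
    proof -
      consider "x = a" "y \<in> A0" | "y = a" "x \<in> A0" | "x \<in> A0" "y \<in> A0"
        using \<open>x \<in> A\<close> \<open>y \<in> A\<close> \<open>x \<noteq> y\<close> A0(1) by blast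
      then show ?thesis
      proof cases
        case 1
        then show ?thesis using aP[of y] vP[of y] A0(2) unfolding P'_def by auto
      next
        case 2
        then show ?thesis using aP[of x] vP[of x] A0(2) unfolding P'_def by auto
      next
        case 3
        then show ?thesis using disj[rule_format, of x y] \<open>x \<noteq> y\<close> A0(2) unfolding P'_def by auto
      qed
    qed
    with new show ?thesis by blast
  qed
qed

section \<open>Vine decompositions\<close>

text \<open>The edge condition of a vine decomposition, for two arbitrary node sets.\<close>

definition touching :: "'a set set \<Rightarrow> 'a set \<Rightarrow> 'a set \<Rightarrow> bool" where
  "touching F S T \<longleftrightarrow> S \<inter> T \<noteq> {} \<or> (\<exists>s\<in>S. \<exists>t\<in>T. {s, t} \<in> F)"

lemma touching_mono: "touching F S T \<Longrightarrow> F \<subseteq> F' \<Longrightarrow> S \<subseteq> S' \<Longrightarrow> T \<subseteq> T' \<Longrightarrow> touching F' S' T'"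
  unfolding touching_def by blast

lemma touching_image:
  assumes "touching F S T"
  shows "touching ((`) f ` F) (f ` S) (f ` T)"
proof (cases "S \<inter> T = {}")
  case True
  then obtain s t where st: "s \<in> S" "t \<in> T" "{s, t} \<in> F"
    using assms unfolding touching_def by blast
  then have "{f s, f t} \<in> (`) f ` F" using imageI[OF st(3), of "(`) f"] by simp
  then show ?thesis using st(1,2) unfolding touching_def by (meson imageI)
next
  case False
  then show ?thesis unfolding touching_def by blast
qed

lemma simple_graph_edge:
  assumes "simple_graph V E" "{a, b} \<in> E"
  shows "a \<in> V" "b \<in> V" "a \<noteq> b"
proof -
  obtain u v where "{a, b} = {u, v}" "u \<noteq> v" "u \<in> V" "v \<in> V"
    using assms unfolding simple_graph_def by blast
  then show "a \<in> V" "b \<in> V" "a \<noteq> b" by (auto simp: doubleton_eq_iff)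
qed

lemma simple_graph_subset:
  assumes "simple_graph V E"
  shows "{e \<in> E. e \<subseteq> V} = E"
proof -
  have "e \<subseteq> V" if e: "e \<in> E" for e
  proof -
    obtain u v where "e = {u, v}" "u \<in> V" "v \<in> V"
      using assms e unfolding simple_graph_def by meson
    then show ?thesis by simp
  qed
  then show ?thesis by blast
qed

text \<open>Induced edges are used so that \<open>V\<close> can shrink to a piece
  \<open>X \<union> C\<close> while \<open>E\<close> stays fixed; \<open>simple_graph_subset\<close>
  recovers the whole graph.\<close>

lemma vine_decomposition_iff:
  "vine_decomposition V {e \<in> E. e \<subseteq> V} N F lab \<longleftrightarrow> is_tree N F \<and> (\<forall>t\<in>N. lab t \<subseteq> V) \<and>
    (\<forall>v\<in>V. connected_in F (node_set N lab v)) \<and>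
    (\<forall>u\<in>V. \<forall>v\<in>V. {u, v} \<in> E \<longrightarrow> touching F (node_set N lab u) (node_set N lab v))"
proof -
  have "node_set N lab v \<subseteq> N" for v unfolding node_set_def by blast
  then show ?thesis
    unfolding vine_decomposition_def induces_connected_iff touching_def by auto
qed

section \<open>Trees under gluing and renaming\<close>

lemma is_tree_singleton: "is_tree {n} {}"
  unfolding is_tree_iff simple_graph_def by (simp add: connected_in_singleton)

text \<open>The cut of an old edge extends by placing the whole second tree on the side of
  \<open>s1\<close>, so that the new edge does not cross it.\<close>

lemma tree_glue_cut:
  assumes T: "is_tree N1 F1" "is_tree N2 F2" and disj: "N1 \<inter> N2 = {}"
    and s: "s1 \<in> N1" "s2 \<in> N2" and e: "{a, b} \<in> F1"
  shows "\<exists>A. a \<in> A \<and> b \<notin> A \<and>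
    (\<forall>x y. x \<in> A \<longrightarrow> y \<notin> A \<longrightarrow> {x, y} \<in> insert {s1, s2} (F1 \<union> F2) \<longrightarrow> x = a \<and> y = b)"
proof -
  have sg: "simple_graph N1 F1" "simple_graph N2 F2" using T unfolding is_tree_iff by auto
  obtain A1 where A1: "a \<in> A1" "b \<notin> A1" "\<And>x y. x \<in> A1 \<Longrightarrow> y \<notin> A1 \<Longrightarrow> {x, y} \<in> F1 \<Longrightarrow> x = a \<and> y = b"
    using T(1) e unfolding is_tree_iff by metis
  define A where "A = (A1 \<inter> N1) \<union> (if s1 \<in> A1 then N2 else {})"
  have in1: "x \<in> A \<longleftrightarrow> x \<in> A1" if "x \<in> N1" for x using that disj unfolding A_def by auto
  have in2: "x \<in> A \<longleftrightarrow> s1 \<in> A1" if "x \<in> N2" for x using that disj unfolding A_def by auto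
  have "x = a \<and> y = b" if xy: "x \<in> A" "y \<notin> A" "{x, y} \<in> insert {s1, s2} (F1 \<union> F2)" for x y
  proof -
    consider "{x, y} = {s1, s2}" | "{x, y} \<in> F1" | "{x, y} \<in> F2" using xy(3) by blast
    then show ?thesis
    proof cases
      case 1
      then show ?thesis using xy(1,2) in1[OF s(1)] in2[OF s(2)] by (auto simp: doubleton_eq_iff)
    next
      case 2
      then have "x \<in> N1" "y \<in> N1" using simple_graph_edge[OF sg(1)] by simp_all
      then show ?thesis using A1(3)[OF _ _ 2] in1 xy(1,2) by simp
    next
      case 3
      then have "x \<in> N2" "y \<in> N2" using simple_graph_edge[OF sg(2)] by simp_all
      then show ?thesis using in2 xy(1,2) by simp
    qed
  qed
  moreover have "a \<in> A" "b \<notin> A" using in1 simple_graph_edge[OF sg(1) e] A1(1,2) by auto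
  ultimately show ?thesis by blast
qed

lemma is_tree_glue:
  assumes T: "is_tree N1 F1" "is_tree N2 F2" and disj: "N1 \<inter> N2 = {}"
    and s: "s1 \<in> N1" "s2 \<in> N2"
  shows "is_tree (N1 \<union> N2) (insert {s1, s2} (F1 \<union> F2))" (is "is_tree ?N ?F")
  unfolding is_tree_iff
proof (intro conjI allI impI)
  have sg: "simple_graph N1 F1" "simple_graph N2 F2" using T unfolding is_tree_iff by auto
  have "s1 \<noteq> s2" using s disj by blast
  show "simple_graph ?N ?F"
    unfolding simple_graph_def
  proof (intro conjI ballI)
    show "finite ?N" using sg unfolding simple_graph_def by blast
    fix e assume "e \<in> ?F"
    then consider "e = {s1, s2}" | "e \<in> F1" | "e \<in> F2" by blast
    then show "\<exists>u v. e = {u, v} \<and> u \<noteq> v \<and> u \<in> ?N \<and> v \<in> ?N"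
    proof cases
      case 1
      then show ?thesis using s \<open>s1 \<noteq> s2\<close> by blast
    next
      case 2
      then show ?thesis using sg(1) unfolding simple_graph_def by (meson UnI1)
    next
      case 3
      then show ?thesis using sg(2) unfolding simple_graph_def by (meson UnI2)
    qed
  qed
  have "connected_in ?F N1" "connected_in ?F N2"
    using T connected_in_mono[of F1 N1 ?F] connected_in_mono[of F2 N2 ?F]
    unfolding is_tree_iff by blast+
  then show "connected_in ?F ?N" using connected_in_Un_edge[OF _ _ s] by blast
  fix a b assume "{a, b} \<in> ?F"
  then consider "a = s1" "b = s2" | "a = s2" "b = s1" | "{a, b} \<in> F1" | "{a, b} \<in> F2"
    by (auto simp: doubleton_eq_iff)
  then show "\<exists>A. a \<in> A \<and> b \<notin> A \<and> (\<forall>x y. x \<in> A \<longrightarrow> y \<notin> A \<longrightarrow> {x, y} \<in> ?F \<longrightarrow> x = a \<and> y = b)"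
  proof cases
    \<comment> \<open>Only the new edge runs between the old node sets, so \<open>N1\<close> and, in
      the other orientation, \<open>N2\<close> are its cuts.\<close>
    case 1
    have "x = s1 \<and> y = s2" if "x \<in> N1" "y \<notin> N1" "{x, y} \<in> ?F" for x y
      using that simple_graph_edge[OF sg(1), of x y] simple_graph_edge[OF sg(2), of x y] disj s
      by (auto simp: doubleton_eq_iff)
    then show ?thesis using 1 s disj by (intro exI[of _ N1]) auto
  next
    case 2
    have "x = s2 \<and> y = s1" if "x \<in> N2" "y \<notin> N2" "{x, y} \<in> ?F" for x y
      using that simple_graph_edge[OF sg(1), of x y] simple_graph_edge[OF sg(2), of x y] disj s
      by (auto simp: doubleton_eq_iff)
    then show ?thesis using 2 s disj by (intro exI[of _ N2]) auto
  next
    case 3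
    then show ?thesis using tree_glue_cut[OF T disj s] by blast
  next
    case 4
    have "N2 \<inter> N1 = {}" using disj by blast
    then show ?thesis using tree_glue_cut[OF T(2,1) _ s(2,1) 4]
      by (simp only: insert_commute[of s2 s1] Un_commute[of F2 F1])
  qed
qed

text \<open>Renaming makes the node sets of two trees disjoint before gluing; cuts are carried over
  as images.\<close>

lemma is_tree_relabel:
  assumes T: "is_tree N F" and f: "inj f"
  shows "is_tree (f ` N) ((`) f ` F)"
  unfolding is_tree_iff
proof (intro conjI allI impI)
  have sg: "simple_graph N F" using T unfolding is_tree_iff by blast
  have edge: "\<exists>x y. {x, y} \<in> F \<and> a = f x \<and> b = f y" if "{a, b} \<in> (`) f ` F" for a b
  proof -
    obtain e where e: "e \<in> F" "{a, b} = f ` e" using \<open>{a, b} \<in> (`) f ` F\<close> by blast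
    then obtain u v where uv: "e = {u, v}" using sg unfolding simple_graph_def by blast
    then have "a = f u \<and> b = f v \<or> a = f v \<and> b = f u" using e(2) by (auto simp: doubleton_eq_iff)
    moreover have "{u, v} \<in> F" "{v, u} \<in> F" using e(1) uv by (simp_all add: insert_commute)
    ultimately show ?thesis by blast
  qed
  show "simple_graph (f ` N) ((`) f ` F)"
    unfolding simple_graph_def
  proof (intro conjI ballI)
    show "finite (f ` N)" using sg unfolding simple_graph_def by blast
    fix e assume "e \<in> (`) f ` F"
    then obtain e' where e': "e' \<in> F" "e = f ` e'" by blast
    then obtain u v where uv: "e' = {u, v}" "u \<noteq> v" "u \<in> N" "v \<in> N"
      using sg unfolding simple_graph_def by blast
    then have "e = {f u, f v}" "f u \<noteq> f v" using e'(2) inj_eq[OF f] by simp_all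
    then show "\<exists>u v. e = {u, v} \<and> u \<noteq> v \<and> u \<in> f ` N \<and> v \<in> f ` N"
      using uv(3,4) by blast
  qed
  show "connected_in ((`) f ` F) (f ` N)"
    using T connected_in_image unfolding is_tree_iff by blast
  fix a b assume "{a, b} \<in> (`) f ` F"
  then obtain x y where xy: "{x, y} \<in> F" "a = f x" "b = f y" using edge by blast
  obtain A where A: "x \<in> A" "y \<notin> A" "\<And>u v. u \<in> A \<Longrightarrow> v \<notin> A \<Longrightarrow> {u, v} \<in> F \<Longrightarrow> u = x \<and> v = y"
    using T xy(1) unfolding is_tree_iff by metis
  have "u = a \<and> v = b" if uv: "u \<in> f ` A" "v \<notin> f ` A" "{u, v} \<in> (`) f ` F" for u v
  proof -
    obtain u' v' where u': "{u', v'} \<in> F" "u = f u'" "v = f v'" using edge[OF uv(3)] by blast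
    then have "u' \<in> A" "v' \<notin> A" using uv inj_image_mem_iff[OF f] by auto
    then show ?thesis using A(3) u' xy by blast
  qed
  then show "\<exists>A. a \<in> A \<and> b \<notin> A \<and>
      (\<forall>u v. u \<in> A \<longrightarrow> v \<notin> A \<longrightarrow> {u, v} \<in> (`) f ` F \<longrightarrow> u = a \<and> v = b)"
    using A(1,2) xy inj_image_mem_iff[OF f] by (intro exI[of _ "f ` A"]) auto
qed

lemma vine_decomposition_relabel:
  assumes "vine_decomposition V {e \<in> E. e \<subseteq> V} N F lab" and f: "inj f"
  shows "vine_decomposition V {e \<in> E. e \<subseteq> V} (f ` N) ((`) f ` F) (lab \<circ> inv f)"
proof -
  have "node_set (f ` N) (lab \<circ> inv f) v = f ` node_set N lab v" for v
    unfolding node_set_def using inv_f_f[OF f] by auto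
  then have ns: "node_set (f ` N) (lab \<circ> inv f) = (\<lambda>v. f ` node_set N lab v)" by blast
  show ?thesis
    using assms(1) is_tree_relabel[OF _ f] inv_f_f[OF f]
    unfolding vine_decomposition_iff ns
    by (simp add: connected_in_image touching_image)
qed

text \<open>The set is a union of the subtrees of the vertices of \<open>Y\<close>, and edges of
  \<open>Y\<close> make these subtrees touch. This turns thicket members into subtrees.\<close>

lemma vine_decomposition_connected:
  assumes D: "vine_decomposition V {e \<in> E. e \<subseteq> V} N F lab" and Y: "connected_in E Y" "Y \<subseteq> V"
  shows "connected_in F {t \<in> N. lab t \<inter> Y \<noteq> {}}" (is "connected_in F ?T")
  unfolding connected_in_def
proof (intro conjI allI impI)
  have sub: "node_set N lab y \<subseteq> ?T" if "y \<in> Y" for y using that unfolding node_set_def by blast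
  have cover: "\<exists>y\<in>Y. t \<in> node_set N lab y" if "t \<in> ?T" for t
    using that unfolding node_set_def by blast
  have conn: "connected_in F (node_set N lab y)" if "y \<in> Y" for y
    using D Y(2) that unfolding vine_decomposition_iff by blast
  then have ne: "node_set N lab y \<noteq> {}" if "y \<in> Y" for y
    using that unfolding connected_in_def by blast
  obtain y where "y \<in> Y" using Y(1) unfolding connected_in_def by blast
  then show "?T \<noteq> {}" using sub[of y] ne[of y] by blast
  fix U assume U: "U \<subseteq> ?T" "U \<noteq> {} \<and> U \<noteq> ?T"
  show "\<exists>a\<in>U. \<exists>b\<in>?T - U. {a, b} \<in> F"
  proof (rule ccontr)
    assume no: "\<not> ?thesis"
    \<comment> \<open>An edge leaving \<open>U\<close> within one subtree would leave
      \<open>U\<close> within \<open>?T\<close>, so each subtree lies in \<open>U\<close> or misses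
      it.\<close>
    have uni: "node_set N lab y \<subseteq> U" if y: "y \<in> Y" "node_set N lab y \<inter> U \<noteq> {}" for y
    proof (rule ccontr)
      assume "\<not> ?thesis"
      then obtain p q where pq: "p \<in> node_set N lab y" "p \<in> U" "q \<in> node_set N lab y" "q \<notin> U"
        using y(2) by blast
      obtain a b where "a \<in> U" "b \<in> node_set N lab y" "b \<notin> U" "{a, b} \<in> F"
        using connected_in_crossing[OF conn[OF y(1)] pq] by metis
      then show False using no sub[OF y(1)] by blast
    qed
    obtain p q where "p \<in> U" "q \<in> ?T" "q \<notin> U" "p \<in> ?T" using U by blast
    then obtain u v where uv: "u \<in> Y" "node_set N lab u \<inter> U \<noteq> {}" "v \<in> Y" "\<not> node_set N lab v \<subseteq> U"
      using cover[of p] cover[of q] by blast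
    \<comment> \<open>Split \<open>Y\<close> by whether the subtree lies in \<open>U\<close>. An
      edge across this split gives touching subtrees, which forces the second one to meet
      \<open>U\<close> as well.\<close>
    obtain a b where ab: "a \<in> Y" "node_set N lab a \<subseteq> U" "b \<in> Y" "\<not> node_set N lab b \<subseteq> U" "{a, b} \<in> E"
      using connected_in_crossing[OF Y(1), of u "{y. node_set N lab y \<subseteq> U}" v] uv uni[OF uv(1,2)]
      by auto
    have "touching F (node_set N lab a) (node_set N lab b)"
      using D ab Y(2) unfolding vine_decomposition_iff by blast
    then have "node_set N lab b \<inter> U \<noteq> {}"
      using no ab(2) sub[OF ab(3)] unfolding touching_def by blast
    then show False using uni ab(3,4) by blast
  qed
qed

text \<open>The bag \<open>X\<close> at \<open>s\<close> is where the pieces for different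
  components are joined; \<open>P\<close> carries admissibility of bags.\<close>

definition rooted_vine :: "'a set set \<Rightarrow> 'a set \<Rightarrow> 'a set \<Rightarrow> ('a set \<Rightarrow> bool) \<Rightarrow> bool" where
  "rooted_vine E X A P \<longleftrightarrow> (\<exists>N F lab s.
     vine_decomposition (X \<union> A) {e \<in> E. e \<subseteq> X \<union> A} N F lab \<and> s \<in> N \<and> lab s = X \<and> (\<forall>t\<in>N. P (lab t)))"

lemma rooted_vine_empty:
  assumes "P X"
  shows "rooted_vine E X {} P"
proof -
  have "node_set {0} (\<lambda>_. X) x = {0}" if "x \<in> X" for x
    using that unfolding node_set_def by auto
  then have "vine_decomposition (X \<union> {}) {e \<in> E. e \<subseteq> X \<union> {}} {0} {} (\<lambda>_. X)"
    unfolding vine_decomposition_iff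
    by (auto simp: is_tree_singleton connected_in_singleton touching_def)
  then show ?thesis using assms unfolding rooted_vine_def by blast
qed

text \<open>Edges between \<open>X\<close> and \<open>C\<close> need no common bag, since the two
  nodes are adjacent in the tree.\<close>

lemma rooted_vine_two:
  assumes "P X" "P C" and disj: "X \<inter> C = {}"
  shows "rooted_vine E X C P"
proof -
  define lab where "lab = (\<lambda>t::nat. if t = 0 then X else C)"
  have T: "is_tree {0, 1} {{0, 1}}"
    using is_tree_glue[OF is_tree_singleton[of 0] is_tree_singleton[of 1], of 0 1]
    by (simp add: insert_commute)
  have l: "\<forall>t\<in>{0, 1}. lab t \<subseteq> X \<union> C" unfolding lab_def by auto
  have "node_set {0, 1} lab x = {0}" if "x \<in> X" for x
    using that disj unfolding node_set_def lab_def by auto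
  moreover have "node_set {0, 1} lab c = {1}" if "c \<in> C" for c
    using that disj unfolding node_set_def lab_def by auto
  ultimately have "vine_decomposition (X \<union> C) {e \<in> E. e \<subseteq> X \<union> C} {0, 1} {{0, 1}} lab"
    unfolding vine_decomposition_iff using T l
    by (auto simp: connected_in_singleton touching_def insert_commute)
  moreover have "lab 0 = X" "\<forall>t\<in>{0, 1}. P (lab t)" using assms(1,2) unfolding lab_def by auto
  ultimately show ?thesis unfolding rooted_vine_def by blast
qed

text \<open>The new tree edge joins the two roots and with them the two subtrees of each vertex of
  \<open>X\<close>. All other vertices occur on one side only, and no edge of \<open>E\<close> joins
  \<open>A\<close> to \<open>C\<close>.\<close>

lemma rooted_vine_glue:
  assumes R: "rooted_vine E X A P" "rooted_vine E X C P"
    and disj: "X \<inter> A = {}" "X \<inter> C = {}" "A \<inter> C = {}"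
    and no_edge: "\<And>a c. a \<in> A \<Longrightarrow> c \<in> C \<Longrightarrow> {a, c} \<notin> E"
  shows "rooted_vine E X (A \<union> C) P"
proof -
  let ?vd = "\<lambda>V. vine_decomposition V {e \<in> E. e \<subseteq> V}"
  obtain M1 G1 k1 r1 where M1: "?vd (X \<union> A) M1 G1 k1" "r1 \<in> M1" "k1 r1 = X" "\<forall>t\<in>M1. P (k1 t)"
    using R(1) unfolding rooted_vine_def by blast
  obtain M2 G2 k2 r2 where M2: "?vd (X \<union> C) M2 G2 k2" "r2 \<in> M2" "k2 r2 = X" "\<forall>t\<in>M2. P (k2 t)"
    using R(2) unfolding rooted_vine_def by blast
  \<comment> \<open>Even and odd numbers keep the two node sets disjoint.\<close>
  define f g :: "nat \<Rightarrow> nat" where "f = (\<lambda>n. 2 * n)" and "g = (\<lambda>n. 2 * n + 1)"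
  have inj: "inj f" "inj g" unfolding f_def g_def inj_def by auto
  define N1 F1 l1 s1 where "N1 = f ` M1" "F1 = (`) f ` G1" "l1 = k1 \<circ> inv f" "s1 = f r1"
  define N2 F2 l2 s2 where "N2 = g ` M2" "F2 = (`) g ` G2" "l2 = k2 \<circ> inv g" "s2 = g r2"
  note defs = N1_F1_l1_s1_def N2_F2_l2_s2_def
  have D1: "?vd (X \<union> A) N1 F1 l1" "s1 \<in> N1" "l1 s1 = X" "\<forall>t\<in>N1. P (l1 t)"
    using vine_decomposition_relabel[OF M1(1) inj(1)] M1(2-4) inv_f_f[OF inj(1)] unfolding defs by auto
  have D2: "?vd (X \<union> C) N2 F2 l2" "s2 \<in> N2" "l2 s2 = X" "\<forall>t\<in>N2. P (l2 t)"
    using vine_decomposition_relabel[OF M2(1) inj(2)] M2(2-4) inv_f_f[OF inj(2)] unfolding defs by auto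
  have N12: "N1 \<inter> N2 = {}" unfolding defs f_def g_def by (auto, presburger)
  define N F l where "N = N1 \<union> N2" and "F = insert {s1, s2} (F1 \<union> F2)"
    and "l = (\<lambda>t. if t \<in> N1 then l1 t else l2 t)"
  have sub: "F1 \<subseteq> F" "F2 \<subseteq> F" unfolding F_def by auto
  have T: "is_tree N F"
    using is_tree_glue[OF _ _ N12 D1(2) D2(2)] D1(1) D2(1)
    unfolding vine_decomposition_iff N_def F_def by blast
  have ns: "node_set N l v = node_set N1 l1 v \<union> node_set N2 l2 v" for v
    using N12 unfolding node_set_def N_def l_def by auto
  have lab1: "l1 t \<subseteq> X \<union> A" if "t \<in> N1" for t using D1(1) that unfolding vine_decomposition_iff by blast
  have lab2: "l2 t \<subseteq> X \<union> C" if "t \<in> N2" for t using D2(1) that unfolding vine_decomposition_iff by blast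
  have nA: "node_set N l a = node_set N1 l1 a" if "a \<in> A" for a
  proof -
    have "node_set N2 l2 a = {}" using that disj lab2 unfolding node_set_def by blast
    then show ?thesis unfolding ns by simp
  qed
  have nC: "node_set N l c = node_set N2 l2 c" if "c \<in> C" for c
  proof -
    have "node_set N1 l1 c = {}" using that disj lab1 unfolding node_set_def by blast
    then show ?thesis unfolding ns by simp
  qed
  have c1: "connected_in F (node_set N1 l1 v)" if "v \<in> X \<union> A" for v
    using D1(1) that connected_in_mono sub(1) unfolding vine_decomposition_iff by blast
  have c2: "connected_in F (node_set N2 l2 v)" if "v \<in> X \<union> C" for v
    using D2(1) that connected_in_mono sub(2) unfolding vine_decomposition_iff by blast
  have conn: "connected_in F (node_set N l v)" if "v \<in> X \<union> (A \<union> C)" for v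
  proof -
    consider "v \<in> X" | "v \<in> A" | "v \<in> C" using \<open>v \<in> X \<union> (A \<union> C)\<close> by blast
    then show ?thesis
    proof cases
      case 1
      then have "s1 \<in> node_set N1 l1 v" "s2 \<in> node_set N2 l2 v"
        using D1(2,3) D2(2,3) unfolding node_set_def by auto
      then show ?thesis
        unfolding ns using 1 c1 c2 by (intro connected_in_Un_edge[where a = s1 and b = s2]) (auto simp: F_def)
    next
      case 2
      then show ?thesis using nA c1 by simp
    next
      case 3
      then show ?thesis using nC c2 by simp
    qed
  qed
  have t1: "touching F (node_set N l u) (node_set N l v)" if "u \<in> X \<union> A" "v \<in> X \<union> A" "{u, v} \<in> E" for u v
    using D1(1) that touching_mono[OF _ sub(1)] unfolding vine_decomposition_iff ns by blast
  have t2: "touching F (node_set N l u) (node_set N l v)" if "u \<in> X \<union> C" "v \<in> X \<union> C" "{u, v} \<in> E" for u v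
    using D2(1) that touching_mono[OF _ sub(2)] unfolding vine_decomposition_iff ns by blast
  have edges: "touching F (node_set N l u) (node_set N l v)"
    if uv: "u \<in> X \<union> (A \<union> C)" "v \<in> X \<union> (A \<union> C)" "{u, v} \<in> E" for u v
  proof -
    have "\<not> (u \<in> A \<and> v \<in> C)" "\<not> (v \<in> A \<and> u \<in> C)"
      using no_edge[of u v] no_edge[of v u] uv(3) by (auto simp: insert_commute)
    then show ?thesis using t1[OF _ _ uv(3)] t2[OF _ _ uv(3)] uv(1,2) by blast
  qed
  have "l t \<subseteq> X \<union> (A \<union> C)" if "t \<in> N" for t
    using lab1[of t] lab2[of t] that unfolding N_def l_def by (cases "t \<in> N1") auto
  then have "?vd (X \<union> (A \<union> C)) N F l"
    unfolding vine_decomposition_iff using T conn edges by blast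
  moreover have "s1 \<in> N" "l s1 = X" "\<forall>t\<in>N. P (l t)"
    using D1 D2 unfolding N_def l_def by auto
  ultimately show ?thesis unfolding rooted_vine_def by blast
qed
section \<open>Duality\<close>

lemma thicket_iff:
  "thicket V E H \<longleftrightarrow> finite H \<and> (\<forall>X\<in>H. X \<subseteq> V \<and> connected_in E X) \<and> (\<forall>X\<in>H. \<forall>Y\<in>H. X \<inter> Y \<noteq> {})"
  unfolding thicket_def induces_connected_iff connected_in_def by blast

lemma thicket_member:
  assumes "thicket V E H" "X \<in> H"
  shows "X \<subseteq> V" "connected_in E X" "\<And>Y. Y \<in> H \<Longrightarrow> X \<inter> Y \<noteq> {}"
  using assms unfolding thicket_iff by simp_all

text \<open>Gives the lower bound on the width: a bag that hits \<open>H\<close> has at least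
  \<open>hitting_size V H\<close> vertices.\<close>

lemma thicket_vine_bag:
  assumes D: "vine_decomposition V {e \<in> E. e \<subseteq> V} N F lab" and H: "thicket V E H"
  shows "\<exists>t\<in>N. hitting_set V H (lab t)"
proof (cases "H = {}")
  case True
  have "N \<noteq> {}" using D unfolding vine_decomposition_iff is_tree_iff connected_in_def by blast
  then show ?thesis using D True unfolding vine_decomposition_iff hitting_set_def by blast
next
  case False
  define S where "S Y = {t \<in> N. lab t \<inter> Y \<noteq> {}}" for Y
  have T: "is_tree N F" using D unfolding vine_decomposition_iff by blast
  have "\<Inter>(S ` H) \<noteq> {}"
  proof (rule tree_Helly[OF T])
    show "finite (S ` H)" "S ` H \<noteq> {}" using H False unfolding thicket_iff by auto
    show "connected_in F T" if "T \<in> S ` H" for T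
    proof -
      obtain Y where "Y \<in> H" "T = S Y" using \<open>T \<in> S ` H\<close> by blast
      then show ?thesis
        using vine_decomposition_connected[OF D] thicket_member(1,2)[OF H] unfolding S_def by blast
    qed
    \<comment> \<open>Two members share a vertex, and any node whose bag contains it lies in both
      subtrees.\<close>
    show "T \<inter> T' \<noteq> {}" if TT: "T \<in> S ` H" "T' \<in> S ` H" for T T'
    proof -
      obtain Y Y' where Y: "Y \<in> H" "T = S Y" "Y' \<in> H" "T' = S Y'" using TT by blast
      then obtain v where v: "v \<in> Y" "v \<in> Y'" "v \<in> V"
        using thicket_member(1,3)[OF H, of Y] by blast
      then have "connected_in F (node_set N lab v)" using D unfolding vine_decomposition_iff by simp
      then obtain t where "t \<in> node_set N lab v" unfolding connected_in_def by blast
      then have "t \<in> T" "t \<in> T'" using Y v unfolding S_def node_set_def by auto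
      then show ?thesis by blast
    qed
  qed
  then obtain t where t: "\<forall>Y\<in>H. t \<in> S Y" by blast
  then have "t \<in> N" using False unfolding S_def by blast
  moreover from this have "lab t \<subseteq> V" using D unfolding vine_decomposition_iff by blast
  ultimately show ?thesis using t unfolding hitting_set_def S_def by blast
qed

text \<open>A member joins \<open>X\<close> to \<open>B\<close>. Unless it ends inside
  \<open>U\<close>, it has an edge leaving \<open>U \<union> C\<close>; vertices of \<open>C\<close>
  have no neighbours there, so the edge starts in the boundary. For a minimum \<open>X\<close> this
  gives the bound that \<open>Menger_linkage\<close> requires.\<close>

lemma boundary_hits:
  assumes H: "thicket V E H" and X: "hitting_set V H X" and B: "hitting_set V H B" "B \<inter> C = {}"
    and C: "\<And>c w. c \<in> C \<Longrightarrow> w \<in> V - X - C \<Longrightarrow> {c, w} \<notin> E"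
    and U: "X \<subseteq> U" "U \<subseteq> V - C"
  shows "hitting_set V H (boundary E (V - C) B U)"
  unfolding hitting_set_def
proof (intro conjI ballI)
  show "boundary E (V - C) B U \<subseteq> V" using U unfolding boundary_def by blast
  fix Y assume Y: "Y \<in> H"
  then have conn: "connected_in E Y" "Y \<subseteq> V" using thicket_member[OF H] by auto
  obtain x where x: "x \<in> X" "x \<in> Y" using X Y unfolding hitting_set_def by blast
  obtain b where b: "b \<in> B" "b \<in> Y" using B Y unfolding hitting_set_def by blast
  show "boundary E (V - C) B U \<inter> Y \<noteq> {}"
  proof (cases "b \<in> U")
    case True
    then show ?thesis using b unfolding boundary_def by blast
  next
    case False
    have "x \<in> U \<union> C" "b \<notin> U \<union> C" using x U b B False by auto
    then obtain p q where pq: "p \<in> Y" "p \<in> U \<union> C" "q \<in> Y" "q \<notin> U \<union> C" "{p, q} \<in> E"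
      using connected_in_crossing[OF conn(1) x(2) _ b(2)] by metis
    then have "q \<in> V - X - C" using conn(2) U by blast
    then have "p \<in> U" using C pq by blast
    then have "p \<in> boundary E (V - C) B U" using pq conn(2) unfolding boundary_def by blast
    then show ?thesis using pq by blast
  qed
qed

text \<open>The new bags arise by contracting the linkage from \<open>X\<close> to the bag of \<open>s\<close>: the node set of
  \<open>x \<in> X\<close> is extended only as far as \<open>s\<close>, so that it stays inside the subtree of every member
  of the thicket containing \<open>x\<close>.\<close>
lemma rooted_vine_restrict:
  assumes fin: "finite V" and D: "vine_decomposition V {e \<in> E. e \<subseteq> V} N F lab"
    and H: "thicket V E H"
    and X: "hitting_set V H X" "card X \<le> k"
    and X_min: "\<And>S. hitting_set V H S \<Longrightarrow> card X \<le> card S"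
    and C: "C \<subseteq> V - X" "\<And>c w. c \<in> C \<Longrightarrow> w \<in> V - X - C \<Longrightarrow> {c, w} \<notin> E"
    and adm: "\<And>t. t \<in> N \<Longrightarrow> card (lab t) \<le> k \<or> \<not> hitting_set V (insert C H) (lab t)"
    and s: "s \<in> N" "hitting_set V H (lab s)" "k < card (lab s)"
  shows "rooted_vine E X C (\<lambda>B. card B \<le> k \<or> \<not> hitting_set V H B)"
proof -
  have T: "is_tree N F" and lab: "\<And>t. t \<in> N \<Longrightarrow> lab t \<subseteq> V"
    and conn: "\<And>v. v \<in> V \<Longrightarrow> connected_in F (node_set N lab v)"
    and edge: "\<And>u v. u \<in> V \<Longrightarrow> v \<in> V \<Longrightarrow> {u, v} \<in> E \<Longrightarrow> touching F (node_set N lab u) (node_set N lab v)"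
    using D unfolding vine_decomposition_iff by auto
  have XV: "X \<subseteq> V" using X unfolding hitting_set_def by blast
  \<comment> \<open>The bag of \<open>s\<close> is large and hits \<open>H\<close>, so admissibility
    for \<open>insert C H\<close> leaves only \<open>C\<close> to be missed.\<close>
  have sC: "lab s \<inter> C = {}" using adm[OF s(1)] s(2,3) unfolding hitting_set_def by auto
  have "\<exists>P. (\<forall>x\<in>X. x \<in> P x \<and> P x \<subseteq> V - C \<and> connected_in E (P x) \<and> P x \<inter> lab s \<noteq> {}) \<and>
    (\<forall>x\<in>X. \<forall>y\<in>X. x \<noteq> y \<longrightarrow> P x \<inter> P y = {})"
  proof (rule Menger_linkage)
    show "finite (V - C)" "X \<subseteq> V - C" using fin XV C(1) by auto
    show "card X \<le> card (boundary E (V - C) (lab s) U)" if "X \<subseteq> U" "U \<subseteq> V - C" for U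
      by (rule X_min, rule boundary_hits[OF H X(1) s(2) sC C(2) that])
  qed
  then obtain P where
    P0: "\<forall>x\<in>X. x \<in> P x \<and> P x \<subseteq> V - C \<and> connected_in E (P x) \<and> P x \<inter> lab s \<noteq> {}" and
    disj: "\<forall>x\<in>X. \<forall>y\<in>X. x \<noteq> y \<longrightarrow> P x \<inter> P y = {}"
    by (elim exE conjE)
  have P: "x \<in> P x" "P x \<subseteq> V - C" "connected_in E (P x)" "P x \<inter> lab s \<noteq> {}" if "x \<in> X" for x
    using P0[rule_format, OF that] by simp_all
  have "\<exists>S. connected_in F S \<and> insert s (node_set N lab x) \<subseteq> S \<and> S \<subseteq> N \<and>
      (\<forall>S'. connected_in F S' \<longrightarrow> insert s (node_set N lab x) \<subseteq> S' \<longrightarrow> S \<subseteq> S')" for x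
  proof -
    have "insert s (node_set N lab x) \<subseteq> N" using s(1) unfolding node_set_def by auto
    then show ?thesis using tree_hull[OF T, of "insert s (node_set N lab x)"] by (metis insert_not_empty)
  qed
  then obtain S where S: "\<And>x. connected_in F (S x)" "\<And>x. insert s (node_set N lab x) \<subseteq> S x" "\<And>x. S x \<subseteq> N"
    "\<And>x S'. connected_in F S' \<Longrightarrow> insert s (node_set N lab x) \<subseteq> S' \<Longrightarrow> S x \<subseteq> S'"
    by metis
  \<comment> \<open>The nodes whose bags meet \<open>Y\<close> form a subtree containing
    \<open>s\<close> and the nodes of \<open>x\<close>, hence all of \<open>S x\<close>. Applied to
    the linkage sets \<open>P x\<close> and to members of \<open>H\<close>.\<close>
  have hull: "lab t \<inter> Y \<noteq> {}"
    if Y: "connected_in E Y" "Y \<subseteq> V" "x \<in> Y" "lab s \<inter> Y \<noteq> {}" and t: "t \<in> S x" for x Y t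
  proof -
    have "insert s (node_set N lab x) \<subseteq> {t \<in> N. lab t \<inter> Y \<noteq> {}}"
      using Y(3,4) s(1) unfolding node_set_def by auto
    from S(4)[OF vine_decomposition_connected[OF D Y(1,2)] this] show ?thesis using t by blast
  qed
  \<comment> \<open>Vertices of \<open>C\<close> keep their nodes and each \<open>x \<in> X\<close>
    receives the hull \<open>S x\<close>. As every hull contains \<open>s\<close> and the old bag of
    \<open>s\<close> misses \<open>C\<close>, the new bag there is \<open>X\<close>.\<close>
  define l where "l t = (lab t \<inter> C) \<union> {x \<in> X. t \<in> S x}" for t
  have nC: "node_set N l c = node_set N lab c" if "c \<in> C" for c
    using that C(1) unfolding node_set_def l_def by auto
  have nX: "node_set N l x = S x" if "x \<in> X" for x
    using that C(1) S(3)[of x] unfolding node_set_def l_def by auto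
  have sub: "node_set N lab v \<subseteq> node_set N l v" if "v \<in> X \<union> C" for v
    using that nC nX S(2) by blast
  have XCV: "X \<union> C \<subseteq> V" using XV C(1) by blast
  have "connected_in F (node_set N l v)" if "v \<in> X \<union> C" for v
    using that nC nX S(1) conn XCV by (metis Un_iff subsetD)
  moreover have "touching F (node_set N l u) (node_set N l v)"
    if "u \<in> X \<union> C" "v \<in> X \<union> C" "{u, v} \<in> E" for u v
    using touching_mono[OF edge] sub that XCV by blast
  moreover have "l t \<subseteq> X \<union> C" for t unfolding l_def by blast
  ultimately have "vine_decomposition (X \<union> C) {e \<in> E. e \<subseteq> X \<union> C} N F l"
    unfolding vine_decomposition_iff using T by blast
  moreover have "l s = X" using sC S(2) unfolding l_def by blast
  moreover have "card (l t) \<le> k \<or> \<not> hitting_set V H (l t)" if t: "t \<in> N" for t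
  proof (rule ccontr)
    assume "\<not> ?thesis"
    then have big: "k < card (l t)" and hit: "hitting_set V H (l t)" by auto
    have finl: "finite (lab t)" using lab[OF t] fin finite_subset by blast
    have PS: "lab t \<inter> P x \<noteq> {}" if x: "x \<in> X" "t \<in> S x" for x
      by (rule hull[OF P(3)[OF x(1)] _ P(1)[OF x(1)] _ x(2)]) (use P(2,4)[OF x(1)] in auto)
    \<comment> \<open>An injection from the new bag into the old one: \<open>x \<in> X\<close> goes
      to a vertex of the old bag in \<open>P x\<close>. The sets \<open>P x\<close> are disjoint and
      avoid \<open>C\<close>, so bags do not grow.\<close>
    define g where "g v = (if v \<in> C then v else (SOME y. y \<in> lab t \<inter> P v))" for v
    have gX: "g x \<in> lab t \<inter> P x" if x: "x \<in> X" "t \<in> S x" for x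
    proof -
      have "x \<notin> C" using x(1) C(1) by blast
      then show ?thesis using some_in_eq[of "lab t \<inter> P x"] PS[OF x] unfolding g_def by simp
    qed
    have gC: "g c = c" if "c \<in> C" for c using that unfolding g_def by simp
    have cases: "v \<in> C \<and> v \<in> lab t \<or> v \<in> X \<and> t \<in> S v" if "v \<in> l t" for v
      using that unfolding l_def by blast
    have "inj_on g (l t)"
    proof (rule inj_onI)
      fix u v assume uv: "u \<in> l t" "v \<in> l t" "g u = g v"
      have ne: "g x \<noteq> c" if "c \<in> C" "x \<in> X" "t \<in> S x" for x c
        using gX[OF that(2,3)] P(2)[OF that(2)] that(1) by blast
      have "u = v" if "u \<in> X" "t \<in> S u" "v \<in> X" "t \<in> S v"
        using gX[OF that(1,2)] gX[OF that(3,4)] disj[rule_format, OF that(1,3)] uv(3) by auto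
      then show "u = v" using cases[OF uv(1)] cases[OF uv(2)] uv(3) gC ne by metis
    qed
    moreover have "g v \<in> lab t" if "v \<in> l t" for v using cases[OF that] gC gX by auto
    ultimately have "card (l t) \<le> card (lab t)"
      using card_inj_on_le[OF _ _ finl] by blast
    then have "\<not> hitting_set V (insert C H) (lab t)" using adm[OF t] big by linarith
    then obtain Y where Y: "Y \<in> insert C H" "lab t \<inter> Y = {}"
      using lab[OF t] unfolding hitting_set_def by blast
    show False
    \<comment> \<open>If the old bag misses \<open>C\<close>, the new one lies in \<open>X\<close>
      and is too small. If it misses a member of \<open>H\<close>, the new bag hits that member in
      some \<open>v \<in> X\<close> with \<open>t \<in> S v\<close>, and \<open>hull\<close> gives a
      contradiction.\<close>
    proof (cases "Y = C")
      case True
      then have "l t \<subseteq> X" using Y unfolding l_def by blast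
      then have "card (l t) \<le> card X" using XV fin by (meson card_mono finite_subset)
      then show False using big X(2) by linarith
    next
      case False
      then have YH: "Y \<in> H" using Y by blast
      then obtain v where v: "v \<in> l t" "v \<in> Y" using hit unfolding hitting_set_def by blast
      then have x: "v \<in> X" "t \<in> S v" using cases Y(2) by blast+
      have "connected_in E Y" "Y \<subseteq> V" using thicket_member[OF H YH] by auto
      moreover have "lab s \<inter> Y \<noteq> {}" using s(2) YH unfolding hitting_set_def by blast
      ultimately show False using hull[of Y v t] v(2) x(2) Y(2) by blast
    qed
  qed
  ultimately show ?thesis unfolding rooted_vine_def using s(1) by blast
qed

text \<open>Thickets are subsets of \<open>Pow V\<close>, so the measure drops whenever a component
  is added to \<open>H\<close>.\<close>

lemma admissible_vine_exists:
  assumes G: "simple_graph V E"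
    and hit: "\<And>H. thicket V E H \<Longrightarrow> \<exists>S. hitting_set V H S \<and> card S \<le> k"
    and "thicket V E H"
  shows "\<exists>N F lab. vine_decomposition V E N F lab \<and>
    (\<forall>t\<in>N. card (lab t) \<le> k \<or> \<not> hitting_set V H (lab t))"
  using assms(3)
proof (induction "card (Pow V) - card H" arbitrary: H rule: less_induct)
  case less
  note H = less.prems
  have fin: "finite V" using G unfolding simple_graph_def by blast
  have EV: "{e \<in> E. e \<subseteq> V} = E" by (rule simple_graph_subset[OF G])
  obtain X where X: "hitting_set V H X" and X_min: "\<And>S. hitting_set V H S \<Longrightarrow> card X \<le> card S"
    using hit[OF H] ex_has_least_nat[of "hitting_set V H" _ card] by metis
  have Xk: "card X \<le> k" using hit[OF H] X_min le_trans by blast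
  have XV: "X \<subseteq> V" using X unfolding hitting_set_def by blast
  let ?P = "\<lambda>B. card B \<le> k \<or> \<not> hitting_set V H B"
  show ?case
  \<comment> \<open>Assuming failure for \<open>H\<close>, every decomposition contains a large bag
    hitting \<open>H\<close>; this supplies the node \<open>s\<close> below.\<close>
  proof (rule ccontr)
    assume none: "\<not> ?case"
    have piece: "rooted_vine E X C ?P"
      if C: "connected_in E C" "C \<subseteq> V - X" "\<And>c w. c \<in> C \<Longrightarrow> w \<in> V - X - C \<Longrightarrow> {c, w} \<notin> E" for C
    proof (cases "\<exists>Y\<in>H. C \<inter> Y = {}")
      case True
      then have "\<not> hitting_set V H C" unfolding hitting_set_def by blast
      then show ?thesis using Xk C(2) by (intro rooted_vine_two) auto
    next
      case False
      have CC: "C \<inter> C \<noteq> {}" using C(1) unfolding connected_in_def by blast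
      have H': "thicket V E (insert C H)"
        using H C(1,2) False CC unfolding thicket_iff by (auto simp: Int_commute)
      then have "insert C H \<subseteq> Pow V" unfolding thicket_iff by blast
      then have "card (insert C H) \<le> card (Pow V)" using fin by (intro card_mono) auto
      \<comment> \<open>\<open>X\<close> meets all members of \<open>H\<close> but not
        \<open>C\<close>, so the thicket really grows.\<close>
      moreover have "C \<notin> H" using X C(2) unfolding hitting_set_def by blast
      then have "card (insert C H) = Suc (card H)" using H unfolding thicket_iff by simp
      ultimately have "card (Pow V) - card (insert C H) < card (Pow V) - card H" by linarith
      from less.hyps[OF this H'] obtain N F lab where D: "vine_decomposition V E N F lab"
        and adm: "\<forall>t\<in>N. card (lab t) \<le> k \<or> \<not> hitting_set V (insert C H) (lab t)" by blast
      obtain s where s: "s \<in> N" "hitting_set V H (lab s)" "k < card (lab s)"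
        using none D not_le by blast
      have "vine_decomposition V {e \<in> E. e \<subseteq> V} N F lab" using D EV by simp
      from rooted_vine_restrict[OF fin this H X Xk X_min C(2,3) _ s] adm show ?thesis by blast
    qed
    \<comment> \<open>The sets \<open>A\<close> are unions of components of \<open>V - X\<close>;
      the induction splits off one component at a time.\<close>
    have "rooted_vine E X A ?P"
      if "A \<subseteq> V - X" "\<And>a w. a \<in> A \<Longrightarrow> w \<in> V - X - A \<Longrightarrow> {a, w} \<notin> E" for A
    proof -
      have "finite A" using that(1) fin finite_subset by blast
      then show ?thesis using that
      proof (induction A rule: finite_psubset_induct)
        case (psubset A)
        show ?case
        proof (cases "A = {}")
          case True
          then show ?thesis using rooted_vine_empty[of ?P X] Xk by simp
        next
          case False
          then obtain v where "v \<in> A" by blast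
          then obtain C where C: "v \<in> C" "C \<subseteq> A" "connected_in E C"
            "\<And>c w. c \<in> C \<Longrightarrow> w \<in> A - C \<Longrightarrow> {c, w} \<notin> E"
            using connected_component_exists[of v A E] by metis
          have Cout: "{c, w} \<notin> E" if "c \<in> C" "w \<in> V - X - C" for c w
            using C(2,4) psubset.prems(2) that by blast
          have "rooted_vine E X C ?P"
            using piece[OF C(3) _ Cout] C(2) psubset.prems(1) by blast
          moreover have "rooted_vine E X (A - C) ?P"
          proof (rule psubset.IH)
            show "A - C \<subset> A" "A - C \<subseteq> V - X" using C(1,2) psubset.prems(1) by auto
            fix a w assume aw: "a \<in> A - C" "w \<in> V - X - (A - C)"
            show "{a, w} \<notin> E"
            proof (cases "w \<in> C")
              case True
              then show ?thesis using C(4)[of w a] aw(1) by (simp add: insert_commute)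
            next
              case False
              then show ?thesis using psubset.prems(2) aw by blast
            qed
          qed
          moreover have "{c, a} \<notin> E" if "c \<in> C" "a \<in> A - C" for c a using C(4) that by blast
          ultimately have "rooted_vine E X (C \<union> (A - C)) ?P"
            using C(2) psubset.prems(1) by (intro rooted_vine_glue) auto
          moreover have "C \<union> (A - C) = A" using C(2) by blast
          ultimately show ?thesis by simp
        qed
      qed
    qed
    from this[of "V - X"] have "rooted_vine E X (V - X) ?P" by simp
    moreover have "X \<union> (V - X) = V" using XV by blast
    ultimately have "\<exists>N F lab. vine_decomposition V E N F lab \<and> (\<forall>t\<in>N. ?P (lab t))"
      unfolding rooted_vine_def by (simp only: EV) blast
    then show False using none by blast
  qed
qed

theorem theorem2p5:
  fixes V :: "'a set" and E :: "'a set set"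
  assumes "simple_graph V E" and "V \<noteq> {}"
  shows "thicket_number V E = vinewidth V E"
proof -
  have fin: "finite V" using assms(1) unfolding simple_graph_def by blast
  have EV: "{e \<in> E. e \<subseteq> V} = E" by (rule simple_graph_subset[OF assms(1)])
  have size_le: "hitting_size V H \<le> card S" if "hitting_set V H S" for H S
    unfolding hitting_size_def using that by (intro Least_le) blast
  have size_attained: "\<exists>S. hitting_set V H S \<and> card S = hitting_size V H" if H: "thicket V E H" for H
  proof -
    \<comment> \<open>\<open>V\<close> itself is a hitting set, so the \<open>LEAST\<close> is
      attained.\<close>
    have "\<forall>Y\<in>H. V \<inter> Y \<noteq> {}" using H unfolding thicket_def by blast
    then have "hitting_set V H V" unfolding hitting_set_def by blast
    then show ?thesis
      unfolding hitting_size_def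
      using LeastI[of "\<lambda>k. \<exists>S. hitting_set V H S \<and> card S = k" "card V"] by blast
  qed
  have "{H. thicket V E H} \<subseteq> Pow (Pow V)" unfolding thicket_def by blast
  then have fin_th: "finite {H. thicket V E H}" using fin finite_subset by blast
  \<comment> \<open>With \<open>fin_th\<close>, the \<open>Max\<close> ranges over a finite nonempty
    set.\<close>
  have empty: "thicket V E {}" unfolding thicket_def by simp
  have bag_le: "card (lab t) \<le> vine_width N lab" "vine_width N lab \<in> (\<lambda>t. card (lab t)) ` N"
    if "vine_decomposition V E N F lab" "t \<in> N" for N F lab t
  proof -
    have "finite N" using that(1)
      unfolding vine_decomposition_def is_tree_def simple_graph_def by blast
    then show "card (lab t) \<le> vine_width N lab" "vine_width N lab \<in> (\<lambda>t. card (lab t)) ` N"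
      unfolding vine_width_def using that(2) by (auto intro!: Max_in)
  qed
  have th_le: "hitting_size V H \<le> thicket_number V E" if "thicket V E H" for H
    unfolding thicket_number_def using fin_th that by (intro Max_ge) auto
  have "\<exists>S. hitting_set V H S \<and> card S \<le> thicket_number V E" if "thicket V E H" for H
    using size_attained[OF that] th_le[OF that] by auto
  \<comment> \<open>Every subset of \<open>V\<close> hits the empty thicket, so admissibility bounds
    all bags.\<close>
  from admissible_vine_exists[OF assms(1) this empty] obtain N F lab
    where D: "vine_decomposition V E N F lab"
      and small: "\<forall>t\<in>N. card (lab t) \<le> thicket_number V E \<or> \<not> hitting_set V {} (lab t)" by blast
  have lab: "\<forall>t\<in>N. lab t \<subseteq> V" using D unfolding vine_decomposition_def by blast
  obtain t where "t \<in> N"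
    using D unfolding vine_decomposition_def is_tree_def induces_connected_def by blast
  then obtain t' where "t' \<in> N" "vine_width N lab = card (lab t')"
    using bag_le(2)[OF D] by blast
  then have "vine_width N lab \<le> thicket_number V E"
    using small lab unfolding hitting_set_def by auto
  moreover have "vinewidth V E \<le> vine_width N lab"
    unfolding vinewidth_def using D by (intro Least_le) blast
  ultimately have "vinewidth V E \<le> thicket_number V E" by linarith
  moreover have "thicket_number V E \<le> vinewidth V E"
  proof -
    obtain N' F' lab' where D': "vine_decomposition V E N' F' lab'" "vine_width N' lab' = vinewidth V E"
      using LeastI_ex[of "\<lambda>k. \<exists>N F lab. vine_decomposition V E N F lab \<and> vine_width N lab = k"] D
      unfolding vinewidth_def by blast
    have "hitting_size V H \<le> vinewidth V E" if H: "thicket V E H" for H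
    proof -
      obtain t where "t \<in> N'" "hitting_set V H (lab' t)"
        using thicket_vine_bag[of V E N' F' lab' H] D'(1) H EV by auto
      then show ?thesis using size_le[of H "lab' t"] bag_le(1)[OF D'(1), of t] D'(2) by linarith
    qed
    then show ?thesis
      unfolding thicket_number_def using fin_th empty by (intro Max.boundedI) auto
  qed
  ultimately show ?thesis by simp
qed

end
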